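(* Let $q$ be an odd prime power, fix $\epsilon\in\mathbb{F}_{q^2}\setminus\mathbb{F}_q$ with $\epsilon^q=-\epsilon$ and put $\delta=\epsilon^2\in\mathbb{F}_q$. Let $a=a_0+\epsilon a_1\in\mathbb{F}_{q^2}^*$ and $b=b_0+\epsilon b_1\in\mathbb{F}_{q^2}\setminus\mathbb{F}_q$ ($a_i,b_i\in\mathbb{F}_q$) with $4a^{q+1}+(b^q-b)^2\neq 0$, and let $\mathcal{B}_{a,b}$ be the surface of $\mathrm{PG}(3,q^2)$ with equation \[ Z^qJ^q-ZJ^{2q-1}+a^q(X^{2q}+Y^{2q})-a(X^2+Y^2)J^{2q-2}=(b^q-b)(X^{q+1}+Y^{q+1})J^{q-1}. \] Then, in the Barlotti--Cofman representation in $\mathrm{PG}(6,q)$, the affine points of $\mathcal{B}_{a,b}$ correspond to the affine points of the quadratic cone $\mathcal{B}'$ with equation \[ x_0x_6+2a_0(x_1x_2+x_3x_4)+a_1\big(x_1^2+x_3^2+\delta(x_2^2+x_4^2)\big)-b_1\big(x_1^2-\delta x_2^2+x_3^2-\delta x_4^2\big)=0, \] whose vertex is $V=(0,0,0,0,0,1,0)$ and whose base (the quadric of $\mathrm{PG}(5,q)$ in the coordinates $x_0,x_1,x_2,x_3,x_4,x_6$ given by the same equation) is a non-degenerate hyperbolic quadric. The Barlotti--Cofman representation of $\mathcal{B}_{a,b}$ is obtained by adjoining to these affine points the spread lines $r_P$ for $P\in\mathcal{B}_{a,b}\cap\{J=0\}$; these are $2q^2+1$ lines of the spread $\mathcal{S}$,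 and among them: if $q\equiv 1\pmod 4$, all $2q^2+1$ are contained in $\mathcal{B}'$; if $q\equiv 3\pmod 4$, exactly one is contained in $\mathcal{B}'$.
   Context: Points of $\mathrm{PG}(3,q^2)$ have homogeneous coordinates $(J,X,Y,Z)$, with plane at infinity $J=0$; points of $\mathrm{PG}(6,q)$ have homogeneous coordinates $(x_0,\dots,x_6)$, with hyperplane at infinity $x_0=0$. Every $c\in\mathbb{F}_{q^2}$ is written uniquely as $c=c_0+\epsilon c_1$ with $c_0,c_1\in\mathbb{F}_q$. Barlotti--Cofman (BC) representation: the affine point $(1,X,Y,Z)$ of $\mathrm{PG}(3,q^2)$ with $X=x_1+\epsilon x_2$, $Y=x_3+\epsilon x_4$, $Z=x_5+\epsilon x_6$ corresponds to the affine point $(1,x_1,\dots,x_6)$ of $\mathrm{PG}(6,q)$; a point $P=(0,u,v,w)$ at infinity corresponds to the spread line $r_P$ of the hyperplane $x_0=0$ consisting of the points $(0,u'_0,u'_1,v'_0,v'_1,w'_0,w'_1)$ with $(u',v',w')=(\lambda u,\lambda v,\lambda w)$, $\lambda\in\mathbb{F}_{q^2}^*$. The lines $r_P$ form a Desarguesian line spread $\mathcal{S}$ of $\{x_0=0\}$. The BC representation of a point set of $\mathrm{PG}(3,q^2)$ is the set of images of its affine points together with the union of the lines $r_P$ over its points $P$ at infinity. *)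

theory Defs
  imports "HOL-Analysis.Cartesian_Space" "HOL-Number_Theory.Number_Theory"
begin

section \<open>Projective spaces over a field\<close>

text \<open>
  Points of the projective space PG(n, K) are the one-dimensional subspaces of the vector space
  of dimension n + 1 over K.  The index type is a numeral type: the coordinates in PG(3, K),
  PG(5, K), PG(6, K) are indexed by the types 4, 6, 7, that is, by the residues 0, ..., n.
\<close>

definition proj_points :: "('k::field ^ 'n::finite) set set" where
  "proj_points = {P. vec.subspace P \<and> vec.dim P = 1}"

definition pt :: "'k::field ^ 'n::finite \<Rightarrow> ('k ^ 'n) set" where
  "pt v = vec.span {v}"

text \<open>The vector with the coordinates listed, numbered from 0.\<close>
definition coords :: "'k::field list \<Rightarrow> 'k ^ 'n::{finite, ring_1}" where
  "coords xs = (\<Sum>i<length xs. axis (of_nat i) (xs ! i))"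

definition at_infinity :: "('k::field ^ 'n::{finite, zero}) set \<Rightarrow> bool" where
  "at_infinity P \<longleftrightarrow> (\<forall>v\<in>P. v $ 0 = 0)"

definition affine_part :: "('k::field ^ 'n::{finite, zero}) set set \<Rightarrow> ('k ^ 'n::{finite, zero}) set set" where
  "affine_part A = {P \<in> A. \<not> at_infinity P}"

definition infinite_part :: "('k::field ^ 'n::{finite, zero}) set set \<Rightarrow> ('k ^ 'n::{finite, zero}) set set" where
  "infinite_part A = {P \<in> A. at_infinity P}"

text \<open>The point set with equation \<open>F = 0\<close>, for homogeneous \<open>F\<close>.\<close>
definition zero_points :: "('k::field ^ 'n::finite \<Rightarrow> 'k) \<Rightarrow> ('k ^ 'n) set set" where
  "zero_points F = {pt v | v. v \<noteq> 0 \<and> F v = 0}"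

definition is_line :: "('k::field ^ 'n::finite) set set \<Rightarrow> bool" where
  "is_line l \<longleftrightarrow> (\<exists>W. vec.subspace W \<and> vec.dim W = 2 \<and> l = {P \<in> proj_points. P \<subseteq> W})"

definition is_line_spread :: "('k::field ^ 'n::finite) set set set \<Rightarrow> ('k ^ 'n) set set \<Rightarrow> bool" where
  "is_line_spread S H \<longleftrightarrow> (\<forall>l\<in>S. is_line l \<and> l \<subseteq> H) \<and> (\<forall>P\<in>H. \<exists>!l. l \<in> S \<and> P \<in> l)"


section \<open>Quadrics and cones\<close>

definition quadratic_form :: "('k::field ^ 'n::finite \<Rightarrow> 'k) \<Rightarrow> bool" where
  "quadratic_form Q \<longleftrightarrow>
     (\<exists>A :: 'k ^ 'n ^ 'n. \<forall>v. Q v = (\<Sum>i\<in>UNIV. \<Sum>j\<in>UNIV. A $ i $ j * v $ i * v $ j))"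

definition polar_form :: "('k::field ^ 'n::finite \<Rightarrow> 'k) \<Rightarrow> 'k ^ 'n \<Rightarrow> 'k ^ 'n \<Rightarrow> 'k" where
  "polar_form Q v w = Q (v + w) - Q v - Q w"

definition singular_points :: "('k::field ^ 'n::finite \<Rightarrow> 'k) \<Rightarrow> ('k ^ 'n) set set" where
  "singular_points Q = {pt v | v. v \<noteq> 0 \<and> Q v = 0 \<and> (\<forall>w. polar_form Q v w = 0)}"

definition nondegenerate_quadric :: "('k::field ^ 'n::finite \<Rightarrow> 'k) \<Rightarrow> bool" where
  "nondegenerate_quadric Q \<longleftrightarrow> quadratic_form Q \<and> singular_points Q = {}"

text \<open>
  A non-degenerate quadric of PG(2m - 1, q) is hyperbolic if it contains projective subspaces
  of dimension m - 1, that is, totally singular subspaces of vector space dimension m.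
\<close>
definition hyperbolic_quadric :: "('k::field ^ 'n::finite \<Rightarrow> 'k) \<Rightarrow> bool" where
  "hyperbolic_quadric Q \<longleftrightarrow> nondegenerate_quadric Q \<and>
     (\<exists>U. vec.subspace U \<and> 2 * vec.dim U = CARD('n) \<and> (\<forall>u\<in>U. Q u = 0))"

text \<open>The points on the lines that join \<open>V\<close> to a point of \<open>D\<close>.\<close>
definition cone_over :: "('k::field ^ 'n::finite) set \<Rightarrow> ('k ^ 'n) set set \<Rightarrow> ('k ^ 'n) set set" where
  "cone_over V D = {P \<in> proj_points. \<exists>R\<in>D. P \<subseteq> vec.span (V \<union> R)}"


section \<open>The Barlotti--Cofman representation\<close>

text \<open>
  The field with q elements is a type of its own, embedded by \<open>emb\<close> into the field
  with \<open>q\<^sup>2\<close> elements.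
\<close>
definition field_embedding :: "('f::field \<Rightarrow> 'e::field) \<Rightarrow> bool" where
  "field_embedding emb \<longleftrightarrow> emb 1 = 1 \<and> (\<forall>x y. emb (x + y) = emb x + emb y) \<and>
     (\<forall>x y. emb (x * y) = emb x * emb y)"

text \<open>The components of \<open>c = c\<^sub>0 + eps c\<^sub>1\<close>.\<close>
definition part0 :: "('f::field \<Rightarrow> 'e::field) \<Rightarrow> 'e \<Rightarrow> 'e \<Rightarrow> 'f" where
  "part0 emb eps c = (THE x. \<exists>y. c = emb x + eps * emb y)"

definition part1 :: "('f::field \<Rightarrow> 'e::field) \<Rightarrow> 'e \<Rightarrow> 'e \<Rightarrow> 'f" where
  "part1 emb eps c = (THE y. \<exists>x. c = emb x + eps * emb y)"

definition bc_vec :: "('f::field \<Rightarrow> 'e::field) \<Rightarrow> 'e \<Rightarrow> 'f \<Rightarrow> 'e \<Rightarrow> 'e \<Rightarrow> 'e \<Rightarrow> 'f ^ 7" where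
  "bc_vec emb eps j X Y Z =
     coords [j, part0 emb eps X, part1 emb eps X, part0 emb eps Y, part1 emb eps Y,
                part0 emb eps Z, part1 emb eps Z]"

text \<open>The images of the affine points of \<open>A\<close>.\<close>
definition bc_affine :: "('f::field \<Rightarrow> 'e::field) \<Rightarrow> 'e \<Rightarrow> ('e ^ 4) set set \<Rightarrow> ('f ^ 7) set set" where
  "bc_affine emb eps A = {pt (bc_vec emb eps 1 X Y Z) | X Y Z. pt (coords [1, X, Y, Z]) \<in> A}"

text \<open>The line \<open>r\<^sub>P\<close> that represents the point \<open>P\<close> at infinity.\<close>
definition spread_line :: "('f::field \<Rightarrow> 'e::field) \<Rightarrow> 'e \<Rightarrow> ('e ^ 4) set \<Rightarrow> ('f ^ 7) set set" where
  "spread_line emb eps P =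
     {pt (bc_vec emb eps 0 (c * u) (c * v) (c * w)) | c u v w.
        P = pt (coords [0, u, v, w]) \<and> c \<noteq> 0}"

definition bc_spread :: "('f::field \<Rightarrow> 'e::field) \<Rightarrow> 'e \<Rightarrow> ('f ^ 7) set set set" where
  "bc_spread emb eps = spread_line emb eps ` infinite_part proj_points"

definition bc_rep :: "('f::field \<Rightarrow> 'e::field) \<Rightarrow> 'e \<Rightarrow> ('e ^ 4) set set \<Rightarrow> ('f ^ 7) set set" where
  "bc_rep emb eps A = bc_affine emb eps A \<union> (\<Union>P\<in>infinite_part A. spread_line emb eps P)"


section \<open>The surface and the quadrics\<close>

definition surface_eq :: "nat \<Rightarrow> 'e::field \<Rightarrow> 'e \<Rightarrow> 'e ^ 4 \<Rightarrow> 'e" where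
  "surface_eq q a b p = (let J = p $ 0; X = p $ 1; Y = p $ 2; Z = p $ 3 in
     Z ^ q * J ^ q - Z * J ^ (2 * q - 1)
       + a ^ q * (X ^ (2 * q) + Y ^ (2 * q)) - a * (X ^ 2 + Y ^ 2) * J ^ (2 * q - 2)
     - (b ^ q - b) * (X ^ (q + 1) + Y ^ (q + 1)) * J ^ (q - 1))"

definition surface :: "nat \<Rightarrow> 'e::field \<Rightarrow> 'e \<Rightarrow> ('e ^ 4) set set" where
  "surface q a b = zero_points (surface_eq q a b)"

definition quadric_eq :: "'f::field \<Rightarrow> 'f \<Rightarrow> 'f \<Rightarrow> 'f \<Rightarrow> 'f \<Rightarrow> 'f \<Rightarrow> 'f \<Rightarrow> 'f \<Rightarrow> 'f \<Rightarrow> 'f \<Rightarrow> 'f" where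
  "quadric_eq \<delta> a0 a1 b1 x0 x1 x2 x3 x4 x6 =
     x0 * x6 + 2 * a0 * (x1 * x2 + x3 * x4) + a1 * (x1 ^ 2 + x3 ^ 2 + \<delta> * (x2 ^ 2 + x4 ^ 2))
       - b1 * (x1 ^ 2 - \<delta> * x2 ^ 2 + x3 ^ 2 - \<delta> * x4 ^ 2)"

definition cone_form :: "'f::field \<Rightarrow> 'f \<Rightarrow> 'f \<Rightarrow> 'f \<Rightarrow> 'f ^ 7 \<Rightarrow> 'f" where
  "cone_form \<delta> a0 a1 b1 x =
     quadric_eq \<delta> a0 a1 b1 (x $ 0) (x $ 1) (x $ 2) (x $ 3) (x $ 4) (x $ 6)"

text \<open>The coordinates \<open>x\<^sub>0, x\<^sub>1, x\<^sub>2, x\<^sub>3, x\<^sub>4, x\<^sub>6\<close> of PG(5, q) have the indices 0, ..., 5.\<close>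
definition base_form :: "'f::field \<Rightarrow> 'f \<Rightarrow> 'f \<Rightarrow> 'f \<Rightarrow> 'f ^ 6 \<Rightarrow> 'f" where
  "base_form \<delta> a0 a1 b1 y =
     quadric_eq \<delta> a0 a1 b1 (y $ 0) (y $ 1) (y $ 2) (y $ 3) (y $ 4) (y $ 5)"

text \<open>PG(5, q) as the hyperplane \<open>x\<^sub>5 = 0\<close> of PG(6, q).\<close>
definition base_embed :: "'f::field ^ 6 \<Rightarrow> 'f ^ 7" where
  "base_embed y = coords [y $ 0, y $ 1, y $ 2, y $ 3, y $ 4, 0, y $ 5]"


section \<open>Basic facts\<close>

lemma coords4:
  fixes x0 x1 x2 x3 :: "'k::field"
  defines "v \<equiv> coords [x0, x1, x2, x3] :: 'k ^ 4"
  shows "v $ 0 = x0" "v $ 1 = x1" "v $ 2 = x2" "v $ 3 = x3"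
  by (simp_all add: v_def coords_def axis_def eval_nat_numeral)

lemma coords6:
  fixes x0 x1 x2 x3 x4 x5 :: "'k::field"
  defines "v \<equiv> coords [x0, x1, x2, x3, x4, x5] :: 'k ^ 6"
  shows "v $ 0 = x0" "v $ 1 = x1" "v $ 2 = x2" "v $ 3 = x3" "v $ 4 = x4" "v $ 5 = x5"
  by (simp_all add: v_def coords_def axis_def eval_nat_numeral)

lemma coords7:
  fixes x0 x1 x2 x3 x4 x5 x6 :: "'k::field"
  defines "v \<equiv> coords [x0, x1, x2, x3, x4, x5, x6] :: 'k ^ 7"
  shows "v $ 0 = x0" "v $ 1 = x1" "v $ 2 = x2" "v $ 3 = x3" "v $ 4 = x4" "v $ 5 = x5" "v $ 6 = x6"
  by (simp_all add: v_def coords_def axis_def eval_nat_numeral)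

lemma UNIV_4: "UNIV = {0, 1, 2, 3 :: 4}"
proof (rule sym, rule card_subset_eq)
  show "card {0, 1, 2, 3 :: 4} = card (UNIV :: 4 set)" by simp
qed simp_all

lemma UNIV_7: "UNIV = {0, 1, 2, 3, 4, 5, 6 :: 7}"
proof (rule sym, rule card_subset_eq)
  show "card {0, 1, 2, 3, 4, 5, 6 :: 7} = card (UNIV :: 7 set)" by simp
qed simp_all

lemma vec4_eq_iff:
  "(v :: 'k ^ 4) = w \<longleftrightarrow> v $ 0 = w $ 0 \<and> v $ 1 = w $ 1 \<and> v $ 2 = w $ 2 \<and> v $ 3 = w $ 3"
proof -
  have "(\<forall>i. v $ i = w $ i) \<longleftrightarrow> (\<forall>i \<in> {0, 1, 2, 3 :: 4}. v $ i = w $ i)"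
    unfolding UNIV_4[symmetric] by simp
  then show ?thesis by (simp add: vec_eq_iff)
qed

lemma vec7_eq_iff:
  "(v :: 'k ^ 7) = w \<longleftrightarrow> v $ 0 = w $ 0 \<and> v $ 1 = w $ 1 \<and> v $ 2 = w $ 2 \<and> v $ 3 = w $ 3
     \<and> v $ 4 = w $ 4 \<and> v $ 5 = w $ 5 \<and> v $ 6 = w $ 6"
proof -
  have "(\<forall>i. v $ i = w $ i) \<longleftrightarrow> (\<forall>i \<in> {0, 1, 2, 3, 4, 5, 6 :: 7}. v $ i = w $ i)"
    unfolding UNIV_7[symmetric] by simp
  then show ?thesis by (simp add: vec_eq_iff)
qed

lemma pt_alt: "pt v = range (\<lambda>k. k *s v)"
  unfolding pt_def by (simp add: vec.span_singleton)

lemma pt_in_proj_points: "v \<noteq> 0 \<Longrightarrow> pt v \<in> proj_points"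
  unfolding proj_points_def pt_def
  using vec.dim_span_eq_card_independent[of "{v}"] by (auto simp: vec.dependent_single)

lemma proj_points_cases:
  assumes "P \<in> proj_points"
  obtains v where "v \<noteq> 0" "P = pt v"
proof -
  have s: "vec.subspace P" and d: "vec.dim P = 1" using assms by (auto simp: proj_points_def)
  obtain B where B: "B \<subseteq> P" "vec.independent B" "P \<subseteq> vec.span B" "card B = vec.dim P"
    using vec.basis_exists by blast
  then obtain v where v: "B = {v}" using d by (metis card_1_singletonE)
  have "P = vec.span B" using B s by (metis vec.span_subspace)
  then show thesis using that[of v] v B by (auto simp: pt_def vec.dependent_single)
qed

lemma pt_eq_iff:
  assumes "v \<noteq> 0"
  shows "pt v = pt w \<longleftrightarrow> (\<exists>k. k \<noteq> 0 \<and> v = k *s w)"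
proof
  assume "pt v = pt w"
  moreover have "v \<in> pt v" by (simp add: pt_def vec.span_base)
  ultimately obtain k where "v = k *s w" by (auto simp: pt_alt)
  then show "\<exists>k. k \<noteq> 0 \<and> v = k *s w" using assms by (intro exI[of _ k]) auto
next
  assume "\<exists>k. k \<noteq> 0 \<and> v = k *s w"
  then obtain k where k: "k \<noteq> 0" "v = k *s w" by blast
  have "pt v \<subseteq> pt w" unfolding pt_alt by (auto simp: k vector_smult_assoc)
  moreover have "l *s w = (l / k) *s v" for l using k by (simp add: vector_smult_assoc)
  then have "pt w \<subseteq> pt v" unfolding pt_alt by blast
  ultimately show "pt v = pt w" by blast
qed

lemma at_infinity_pt: "at_infinity (pt v) \<longleftrightarrow> v $ 0 = 0"
proof
  assume "at_infinity (pt v)"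
  moreover have "v \<in> pt v" by (simp add: pt_def vec.span_base)
  ultimately show "v $ 0 = 0" by (simp add: at_infinity_def)
next
  assume "v $ 0 = 0"
  then show "at_infinity (pt v)" by (auto simp: at_infinity_def pt_alt)
qed

context
  fixes emb :: "'f::{field, finite} \<Rightarrow> 'e::{field, finite}" and eps :: 'e
  assumes emb: "field_embedding emb" and eps: "eps \<notin> range emb"
    and card_e: "CARD('e) = CARD('f) ^ 2"
begin

lemma emb_simps: "emb 1 = 1" "emb (x + y) = emb x + emb y" "emb (x * y) = emb x * emb y"
  using emb by (auto simp: field_embedding_def)

lemma emb_0: "emb 0 = 0"
  using emb_simps(2)[of 0 0] by (metis add_0_right add_left_cancel)

lemma emb_diff: "emb (x - y) = emb x - emb y"
  using emb_simps(2)[of "x - y" y] by simp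

lemma emb_0_iff: "emb x = 0 \<longleftrightarrow> x = 0"
proof
  assume "emb x = 0"
  show "x = 0"
  proof (rule ccontr)
    assume "x \<noteq> 0"
    then have "emb x * emb (inverse x) = 1" by (simp add: emb_simps(1) flip: emb_simps(3))
    with \<open>emb x = 0\<close> show False by simp
  qed
qed (simp add: emb_0)

lemma split_0:
  assumes "emb x + eps * emb y = 0"
  shows "x = 0 \<and> y = 0"
proof (cases "y = 0")
  case True
  then show ?thesis using assms by (simp add: emb_0 emb_0_iff)
next
  case False
  have "emb y * emb (inverse y) = 1" using False by (simp add: emb_simps(1) flip: emb_simps(3))
  moreover have "eps * (emb y * emb (inverse y)) = - (emb x * emb (inverse y))"
    using assms by (metis add.commute add_eq_0_iff mult.assoc mult_minus_left)
  ultimately have "eps = - (emb x * emb (inverse y))" by simp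
  also have "\<dots> = emb (0 - x * inverse y)" by (subst emb_diff) (simp add: emb_simps emb_0)
  finally show ?thesis using eps by blast
qed

lemma split_eq_iff: "emb x + eps * emb y = emb x' + eps * emb y' \<longleftrightarrow> x = x' \<and> y = y'"
proof
  assume "emb x + eps * emb y = emb x' + eps * emb y'"
  then have "emb (x - x') + eps * emb (y - y') = 0" by (simp add: emb_diff algebra_simps)
  then show "x = x' \<and> y = y'" using split_0 by fastforce
qed simp

lemma split_exists: "\<exists>x y. c = emb x + eps * emb y"
proof -
  let ?f = "\<lambda>(x, y). emb x + eps * emb y"
  have "inj ?f" by (auto simp: inj_def split_eq_iff)
  then have "card (range ?f) = CARD('f \<times> 'f)" by (rule card_image)
  also have "\<dots> = CARD('e)" by (simp add: card_e power2_eq_square)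
  finally have "range ?f = UNIV" by (intro card_subset_eq) auto
  then have "c \<in> range ?f" by simp
  then show ?thesis by auto
qed

lemma parts_split: "part0 emb eps (emb x + eps * emb y) = x" "part1 emb eps (emb x + eps * emb y) = y"
  by (auto simp: part0_def part1_def split_eq_iff)

lemma parts_add:
  "part0 emb eps (c + d) = part0 emb eps c + part0 emb eps d"
  "part1 emb eps (c + d) = part1 emb eps c + part1 emb eps d"
proof -
  obtain x y x' y' where "c = emb x + eps * emb y" "d = emb x' + eps * emb y'"
    using split_exists by metis
  moreover from this have "c + d = emb (x + x') + eps * emb (y + y')"
    by (simp add: emb_simps algebra_simps)
  ultimately show "part0 emb eps (c + d) = part0 emb eps c + part0 emb eps d"
    "part1 emb eps (c + d) = part1 emb eps c + part1 emb eps d"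
    by (simp_all only: parts_split)
qed

lemma parts_scale:
  "part0 emb eps (emb k * c) = k * part0 emb eps c"
  "part1 emb eps (emb k * c) = k * part1 emb eps c"
proof -
  obtain x y where "c = emb x + eps * emb y" using split_exists by metis
  moreover from this have "emb k * c = emb (k * x) + eps * emb (k * y)"
    by (simp add: emb_simps algebra_simps)
  ultimately show "part0 emb eps (emb k * c) = k * part0 emb eps c"
    "part1 emb eps (emb k * c) = k * part1 emb eps c"
    by (simp_all only: parts_split)
qed

lemma parts_eq_iff: "part0 emb eps c = part0 emb eps d \<and> part1 emb eps c = part1 emb eps d \<longleftrightarrow> c = d"
  using split_exists[of c] split_exists[of d] by (auto simp: parts_split)

lemma bc_vec_eq_iff:
  "bc_vec emb eps j u v w = bc_vec emb eps j' u' v' w' \<longleftrightarrow> j = j' \<and> u = u' \<and> v = v' \<and> w = w'"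
  by (auto simp: vec7_eq_iff bc_vec_def coords7 simp flip: parts_eq_iff)

lemma bc_vec_scale:
  "k *s bc_vec emb eps j u v w = bc_vec emb eps (k * j) (emb k * u) (emb k * v) (emb k * w)"
  by (simp add: vec7_eq_iff bc_vec_def coords7 parts_scale)

lemma bc_vec_add:
  "bc_vec emb eps j u v w + bc_vec emb eps j' u' v' w' =
     bc_vec emb eps (j + j') (u + u') (v + v') (w + w')"
  by (simp add: vec7_eq_iff bc_vec_def coords7 parts_add)

lemma bc_vec_exists: "\<exists>u v w. x = bc_vec emb eps (x $ 0) u v w"
  by (rule exI[of _ "emb (x $ 1) + eps * emb (x $ 2)"], rule exI[of _ "emb (x $ 3) + eps * emb (x $ 4)"],
      rule exI[of _ "emb (x $ 5) + eps * emb (x $ 6)"])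
     (simp add: vec7_eq_iff bc_vec_def coords7 parts_split)

lemma bc_vec_0: "bc_vec emb eps 0 0 0 0 = 0"
  using bc_vec_scale[of 0 0 0 0 0] by (simp add: emb_0)

lemma bc_vec_0_iff: "bc_vec emb eps 0 u v w = 0 \<longleftrightarrow> u = 0 \<and> v = 0 \<and> w = 0"
  using bc_vec_eq_iff[of 0 u v w 0 0 0 0] by (simp add: bc_vec_0)

lemma coords_inf_0_iff: "(coords [0, u, v, w] :: 'e ^ 4) = 0 \<longleftrightarrow> u = 0 \<and> v = 0 \<and> w = 0"
  by (simp add: vec4_eq_iff coords4)

lemma coords_inf_scale: "k *s (coords [0, u, v, w] :: 'e ^ 4) = coords [0, k * u, k * v, k * w]"
  by (simp add: vec4_eq_iff coords4)

lemma spread_line_pt: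
  assumes "(coords [0, u, v, w] :: 'e ^ 4) \<noteq> 0"
  shows "spread_line emb eps (pt (coords [0, u, v, w])) =
           {pt (bc_vec emb eps 0 (c * u) (c * v) (c * w)) | c. c \<noteq> 0}" (is "?l = ?r")
proof
  show "?r \<subseteq> ?l" by (auto simp: spread_line_def)
  show "?l \<subseteq> ?r"
  proof
    fix R assume "R \<in> ?l"
    then obtain c u' v' w' where R: "R = pt (bc_vec emb eps 0 (c * u') (c * v') (c * w'))" "c \<noteq> 0"
      and e: "pt (coords [0, u, v, w] :: 'e ^ 4) = pt (coords [0, u', v', w'])"
      by (auto simp: spread_line_def)
    from e obtain k where k: "k \<noteq> 0" "coords [0, u, v, w] = k *s (coords [0, u', v', w'] :: 'e ^ 4)"
      using pt_eq_iff[OF assms] by blast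
    then have "u' = u / k" "v' = v / k" "w' = w / k" by (auto simp: vec4_eq_iff coords4)
    then show "R \<in> ?r" using R k by (intro CollectI exI[of _ "c / k"]) simp
  qed
qed

lemma infinite_point_cases:
  assumes "P \<in> infinite_part (proj_points :: ('e ^ 4) set set)"
  obtains u v w where "(coords [0, u, v, w] :: 'e ^ 4) \<noteq> 0" "P = pt (coords [0, u, v, w])"
proof -
  obtain p where p: "p \<noteq> 0" "P = pt p" "p $ 0 = 0"
    using assms by (metis (no_types, lifting) at_infinity_pt infinite_part_def mem_Collect_eq proj_points_cases)
  then have "p = coords [0, p $ 1, p $ 2, p $ 3]" by (simp add: vec4_eq_iff coords4)
  then show thesis using that p by metis
qed

lemma is_line_spread_line:
  assumes "P \<in> infinite_part (proj_points :: ('e ^ 4) set set)"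
  shows "is_line (spread_line emb eps P)"
proof -
  obtain u v w where nz: "(coords [0, u, v, w] :: 'e ^ 4) \<noteq> 0" and P: "P = pt (coords [0, u, v, w])"
    using infinite_point_cases[OF assms] .
  define g where "g c = bc_vec emb eps 0 (c * u) (c * v) (c * w)" for c
  have g_add: "g c + g d = g (c + d)" for c d by (simp add: g_def bc_vec_add algebra_simps)
  have g_scale: "k *s g c = g (emb k * c)" for k c by (simp add: g_def bc_vec_scale mult.assoc)
  have g_0: "g c = 0 \<longleftrightarrow> c = 0" for c
    using nz by (auto simp: g_def bc_vec_0_iff coords_inf_0_iff)
  have g_inj: "g c = g d \<longleftrightarrow> c = d" for c d
    using nz by (auto simp: g_def bc_vec_eq_iff coords_inf_0_iff)
  have sub: "vec.subspace (range g)"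
    unfolding vec.subspace_def using g_0[of 0] by (auto simp: g_add g_scale intro: range_eqI[of _ _ 0])
  have ne: "g eps \<noteq> g 1" using eps emb_simps(1) by (metis g_inj rangeI)
  have eps0: "eps \<noteq> 0" using eps emb_0 by (metis rangeI)
  have sp: "range g = vec.span {g 1, g eps}"
  proof
    show "vec.span {g 1, g eps} \<subseteq> range g" by (rule vec.span_minimal[OF _ sub]) auto
    show "range g \<subseteq> vec.span {g 1, g eps}"
    proof
      fix x assume "x \<in> range g"
      then obtain c where "x = g c" by blast
      moreover obtain y z where "c = emb y + eps * emb z" using split_exists by blast
      ultimately have "x = y *s g 1 + z *s g eps" by (simp add: g_scale g_add mult.commute)
      then show "x \<in> vec.span {g 1, g eps}"
        by (simp add: vec.span_add vec.span_scale vec.span_base)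
    qed
  qed
  have "g eps \<notin> vec.span {g 1}"
    using eps by (auto simp: vec.span_singleton g_scale g_inj)
  then have ind: "vec.independent {g eps, g 1}"
    using g_0[of 1] ne by (simp add: vec.independent_insert)
  have "vec.dim (range g) = 2"
    using vec.dim_span_eq_card_independent[OF ind] ne by (simp add: sp insert_commute)
  moreover have "spread_line emb eps P = {R \<in> proj_points. R \<subseteq> range g}" (is "_ = ?r")
  proof
    have l: "spread_line emb eps P = {pt (g c) | c. c \<noteq> 0}"
      unfolding P spread_line_pt[OF nz] g_def ..
    show "spread_line emb eps P \<subseteq> ?r"
    proof
      fix R assume "R \<in> spread_line emb eps P"
      then obtain c where c: "c \<noteq> 0" "R = pt (g c)" by (auto simp: l)
      have "pt (g c) \<in> proj_points" using c g_0 by (intro pt_in_proj_points) simp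
      moreover have "pt (g c) \<subseteq> range g" unfolding pt_def by (rule vec.span_minimal[OF _ sub]) simp
      ultimately show "R \<in> ?r" using c by simp
    qed
    show "?r \<subseteq> spread_line emb eps P"
    proof
      fix R assume R: "R \<in> ?r"
      then have "R \<in> proj_points" "R \<subseteq> range g" by simp_all
      then obtain x where x: "x \<noteq> 0" "R = pt x" by (metis proj_points_cases)
      have "x \<in> R" unfolding x pt_def by (simp add: vec.span_base)
      then have "x \<in> range g" using \<open>R \<subseteq> range g\<close> by blast
      then obtain c where "x = g c" by blast
      then show "R \<in> spread_line emb eps P" unfolding l using x g_0[of c] by blast
    qed
  qed
  ultimately show ?thesis unfolding is_line_def using sub by blast
qed

lemma bc_spread_is_line_spread:
  "is_line_spread (bc_spread emb eps) (infinite_part proj_points)"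
  unfolding is_line_spread_def
proof (intro conjI ballI)
  fix l assume "l \<in> bc_spread emb eps"
  then obtain P where P: "P \<in> infinite_part proj_points" "l = spread_line emb eps P"
    by (auto simp: bc_spread_def)
  show "is_line l" using P is_line_spread_line by simp
  obtain u v w where nz: "(coords [0, u, v, w] :: 'e ^ 4) \<noteq> 0" "P = pt (coords [0, u, v, w])"
    using infinite_point_cases[OF P(1)] .
  show "l \<subseteq> infinite_part proj_points"
  proof
    fix R assume "R \<in> l"
    then obtain c where c: "c \<noteq> 0" "R = pt (bc_vec emb eps 0 (c * u) (c * v) (c * w))"
      using P nz spread_line_pt[OF nz(1)] by auto
    have "bc_vec emb eps 0 (c * u) (c * v) (c * w) \<noteq> 0"
      using c nz by (auto simp: bc_vec_0_iff coords_inf_0_iff)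
    moreover have "bc_vec emb eps 0 (c * u) (c * v) (c * w) $ 0 = 0" by (simp add: bc_vec_def coords7)
    ultimately show "R \<in> infinite_part proj_points"
      by (simp add: infinite_part_def c at_infinity_pt pt_in_proj_points)
  qed
next
  fix R :: "('f ^ 7) set" assume "R \<in> infinite_part proj_points"
  then obtain x where x: "x \<noteq> 0" "R = pt x" "x $ 0 = 0"
    by (metis (no_types, lifting) at_infinity_pt infinite_part_def mem_Collect_eq proj_points_cases)
  obtain u v w where uvw: "x = bc_vec emb eps 0 u v w" using bc_vec_exists[of x] x by metis
  have nz: "(coords [0, u, v, w] :: 'e ^ 4) \<noteq> 0"
    using x uvw by (auto simp: bc_vec_0_iff coords_inf_0_iff)
  show "\<exists>!l. l \<in> bc_spread emb eps \<and> R \<in> l"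
  proof (rule ex1I)
    have "pt (coords [0, u, v, w] :: 'e ^ 4) \<in> infinite_part proj_points"
      using nz by (simp add: infinite_part_def pt_in_proj_points at_infinity_pt coords4)
    moreover have "R \<in> spread_line emb eps (pt (coords [0, u, v, w]))"
      unfolding spread_line_pt[OF nz] using x uvw
      by (intro CollectI exI[of _ 1]) simp
    ultimately show "spread_line emb eps (pt (coords [0, u, v, w])) \<in> bc_spread emb eps \<and>
        R \<in> spread_line emb eps (pt (coords [0, u, v, w]))"
      by (simp add: bc_spread_def)
  next
    fix l assume l: "l \<in> bc_spread emb eps \<and> R \<in> l"
    then obtain P where P: "P \<in> infinite_part proj_points" "l = spread_line emb eps P"
      by (auto simp: bc_spread_def)
    obtain u' v' w' where nz': "(coords [0, u', v', w'] :: 'e ^ 4) \<noteq> 0" "P = pt (coords [0, u', v', w'])"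
      using infinite_point_cases[OF P(1)] .
    obtain c where c: "c \<noteq> 0" "R = pt (bc_vec emb eps 0 (c * u') (c * v') (c * w'))"
      using l P nz' spread_line_pt[OF nz'(1)] by auto
    then obtain k where k: "k \<noteq> 0" "x = k *s bc_vec emb eps 0 (c * u') (c * v') (c * w')"
      using pt_eq_iff[OF x(1)] x by auto
    then have "coords [0, u, v, w] = (emb k * c) *s (coords [0, u', v', w'] :: 'e ^ 4)"
      by (simp add: uvw bc_vec_scale bc_vec_eq_iff coords_inf_scale mult.assoc)
    moreover have "emb k * c \<noteq> 0" using k c by (simp add: emb_0_iff)
    ultimately have "pt (coords [0, u, v, w] :: 'e ^ 4) = P"
      using nz nz' pt_eq_iff by blast
    then show "l = spread_line emb eps (pt (coords [0, u, v, w]))" using P by simp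
  qed
qed

end

end

theory Submission
  imports Defs
begin

text \<open>
  Raising to the power \<open>q\<close> sends \<open>x + eps y\<close> to \<open>x - eps y\<close>, so the affine equation of the surface
  is \<open>-2 eps\<close> times the quadratic form of the cone.  That form is \<open>x\<^sub>0 x\<^sub>6\<close> plus two copies of one
  binary form; the non-vanishing hypothesis says that four times the discriminant of the binary
  form is not zero, and the sum of two copies of a non-degenerate binary form over a finite field
  is hyperbolic because the form has a similarity with factor -1.  At infinity the surface
  becomes \<open>(X\<^sup>2 + Y\<^sup>2)\<^sup>q = 0\<close>: two lines through \<open>(0, 0, 0, 1)\<close>, since -1 is a square in the field
  with \<open>q\<^sup>2\<close> elements.  On such a point the form of the cone reduces to a multiple of
  \<open>X\<^sup>q\<^sup>+\<^sup>1 + Y\<^sup>q\<^sup>+\<^sup>1\<close>, and a square root of -1 has norm \<open>(-1)\<close> to the power \<open>(q + 1) / 2\<close>.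
\<close>

section \<open>Finite fields of odd order\<close>

text \<open>Multiplication by a nonzero \<open>x\<close> permutes the nonzero elements. Comparing
  their product before and after gives \<open>x ^ card ?N = 1\<close>.\<close>

lemma power_CARD_eq_self:
  fixes x :: "'a::{field, finite}"
  shows "x ^ CARD('a) = x"
proof (cases "x = 0")
  case True
  then show ?thesis by (simp add: power_0_left)
next
  case False
  let ?N = "UNIV - {0 :: 'a}"
  have "bij_betw ((*) x) ?N ?N"
    by (rule bij_betw_byWitness[where f' = "\<lambda>y. y / x"]) (use False in auto)
  then have "(\<Prod>y\<in>?N. x * y) = \<Prod>?N"
    by (rule prod.reindex_bij_betw)
  moreover have "\<Prod>?N \<noteq> 0" by simp
  ultimately have "x ^ card ?N = 1" by (simp add: prod.distrib)
  moreover have "CARD('a) = Suc (card ?N)"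
    by (metis card.remove finite_class.finite_UNIV UNIV_I)
  ultimately show ?thesis by (simp only: power_Suc mult_1_right)
qed

text \<open>The characteristic divides the order of the field, so an odd order excludes
  characteristic 2.\<close>

lemma two_neq_0_odd_CARD:
  assumes "odd (CARD('a::{field, finite}))"
  shows "(2 :: 'a) \<noteq> 0"
proof
  assume "(2 :: 'a) = 0"
  then have "CHAR('a) dvd 2" by (metis of_nat_eq_0_iff_char_dvd of_nat_numeral)
  moreover have "CHAR('a) \<noteq> 1" by simp
  ultimately have "CHAR('a) = 2" by (metis prime_nat_iff two_is_prime_nat)
  then show False using CHAR_dvd_CARD[where 'a = 'a] assms by simp
qed

text \<open>At least (q + 1) / 2 elements are squares, so the sets of the \<open>x\<^sup>2\<close> and of the
  \<open>c - d y\<^sup>2\<close> meet.\<close>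
lemma binary_diagonal_form_surj:
  fixes c d :: "'a::{field, finite}"
  assumes "odd (CARD('a))" "d \<noteq> 0"
  obtains x y where "x ^ 2 + d * y ^ 2 = c"
proof -
  define S where "S = range (\<lambda>x :: 'a. x ^ 2)"
  define T where "T = (\<lambda>s. c - d * s) ` S"
  \<comment> \<open>The fibres of squaring cover the field, and each has at most two
    elements.\<close>
  have "UNIV = (\<Union>s\<in>S. {x. x ^ 2 = s})" by (auto simp: S_def)
  then have "CARD('a) \<le> (\<Sum>s\<in>S. card {x. x ^ 2 = s})"
    by (metis card_UN_le finite_code)
  also have "\<dots> \<le> (\<Sum>s\<in>S. 2)"
  proof (rule sum_mono)
    fix s assume "s \<in> S"
    then obtain y where "s = y ^ 2" by (auto simp: S_def)
    then have "{x. x ^ 2 = s} \<subseteq> {y, - y}" by (auto simp: power2_eq_iff)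
    then have "card {x. x ^ 2 = s} \<le> card {y, - y}" by (intro card_mono) auto
    also have "\<dots> \<le> 2" by (simp add: card_insert_if)
    finally show "card {x. x ^ 2 = s} \<le> 2" .
  qed
  finally have S: "CARD('a) \<le> 2 * card S" by simp
  have T: "card T = card S"
    unfolding T_def using assms(2) by (intro card_image) (auto simp: inj_on_def)
  \<comment> \<open>Disjoint \<open>S\<close> and \<open>T\<close> would split the field into two
    halves of equal size, against its odd order.\<close>
  have "S \<inter> T \<noteq> {}"
  proof
    assume "S \<inter> T = {}"
    then have "card (S \<union> T) = 2 * card S" using T by (simp add: card_Un_disjoint)
    moreover have "card (S \<union> T) \<le> CARD('a)" by (intro card_mono) auto
    ultimately have "CARD('a) = 2 * card S" using S by simp
    then show False using assms(1) by simp
  qed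
  then obtain x y where "x ^ 2 = c - d * y ^ 2" by (auto simp: S_def T_def)
  then show thesis using that by (simp add: algebra_simps)
qed


section \<open>Quadratic forms\<close>

text \<open>Together with closure under sums this spares a coefficient matrix for each concrete
  form; here the matrix has the single entry \<open>c\<close>.\<close>

lemma quadratic_form_monomial:
  "quadratic_form (\<lambda>v :: 'k::field ^ 'n::finite. c * (v $ i * v $ j))"
  unfolding quadratic_form_def
proof (intro exI allI)
  fix v :: "'k ^ 'n"
  let ?A = "(\<chi> k l. if k = i then (if l = j then c else 0) else 0) :: 'k ^ 'n ^ 'n"
  have "(\<Sum>l\<in>UNIV. ?A $ k $ l * v $ k * v $ l) = (if k = i then c * (v $ i * v $ j) else 0)" for k
  proof -
    have "?A $ k $ l * v $ k * v $ l = (if l = j then if k = i then c * (v $ i * v $ j) else 0 else 0)" for l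
      by simp
    then show ?thesis by (simp only: sum.delta' sum.delta finite_class.finite_UNIV UNIV_I if_True)
  qed
  then show "c * (v $ i * v $ j) = (\<Sum>k\<in>UNIV. \<Sum>l\<in>UNIV. ?A $ k $ l * v $ k * v $ l)"
    by (simp only: sum.delta' sum.delta finite_class.finite_UNIV UNIV_I if_True)
qed

lemma quadratic_form_add:
  assumes "quadratic_form F" "quadratic_form G"
  shows "quadratic_form (\<lambda>v. F v + G v)"
proof -
  obtain A where A: "F v = (\<Sum>i\<in>UNIV. \<Sum>j\<in>UNIV. A $ i $ j * v $ i * v $ j)" for v
    using assms(1) unfolding quadratic_form_def by blast
  obtain B where B: "G v = (\<Sum>i\<in>UNIV. \<Sum>j\<in>UNIV. B $ i $ j * v $ i * v $ j)" for v
    using assms(2) unfolding quadratic_form_def by blast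
  show ?thesis
    unfolding quadratic_form_def
    by (rule exI[of _ "A + B"]) (simp add: A B sum.distrib distrib_right)
qed

text \<open>The indices and the dimension are arbitrary, so that the cone in 7 coordinates and its
  base in 6 are covered at once.\<close>

lemma quadratic_form_quadric_eq:
  "quadratic_form (\<lambda>v :: 'k::field ^ 'n::finite.
     quadric_eq \<delta> a0 a1 b1 (v $ i) (v $ j) (v $ k) (v $ l) (v $ m) (v $ n))"
proof -
  have "(\<lambda>v :: 'k ^ 'n. quadric_eq \<delta> a0 a1 b1 (v $ i) (v $ j) (v $ k) (v $ l) (v $ m) (v $ n)) =
    (\<lambda>v. 1 * (v $ i * v $ n) + (2 * a0 * (v $ j * v $ k) + (2 * a0 * (v $ l * v $ m)
       + ((a1 - b1) * (v $ j * v $ j) + ((a1 - b1) * (v $ l * v $ l)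
       + (\<delta> * (a1 + b1) * (v $ k * v $ k) + \<delta> * (a1 + b1) * (v $ m * v $ m)))))))"
    by (rule ext) (simp add: quadric_eq_def power2_eq_square algebra_simps)
  then show ?thesis
    by (simp only:) (rule quadratic_form_add quadratic_form_monomial)+
qed

text \<open>The polar form is a hyperbolic pair in the coordinates 0 and 6 plus twice two copies of
  the symmetric matrix with diagonal \<open>a1 - b1\<close>, \<open>\<delta> * (a1 + b1)\<close> and
  off-diagonal entry \<open>a0\<close>.\<close>

lemma quadric_eq_polar:
  fixes \<delta> a0 a1 b1 x0 x1 x2 x3 x4 x6 y0 y1 y2 y3 y4 y6 :: "'k::field"
  shows "quadric_eq \<delta> a0 a1 b1 (x0 + y0) (x1 + y1) (x2 + y2) (x3 + y3) (x4 + y4) (x6 + y6)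
     - quadric_eq \<delta> a0 a1 b1 x0 x1 x2 x3 x4 x6 - quadric_eq \<delta> a0 a1 b1 y0 y1 y2 y3 y4 y6 =
     x0 * y6 + x6 * y0 + 2 * (((a1 - b1) * x1 + a0 * x2) * y1 + (a0 * x1 + \<delta> * (a1 + b1) * x2) * y2
       + ((a1 - b1) * x3 + a0 * x4) * y3 + (a0 * x3 + \<delta> * (a1 + b1) * x4) * y4)"
  by (simp add: quadric_eq_def power2_eq_square algebra_simps)

lemma quadric_eq_scale:
  "quadric_eq \<delta> a0 a1 b1 (k * x0) (k * x1) (k * x2) (k * x3) (k * x4) (k * x6) =
     k ^ 2 * quadric_eq \<delta> a0 a1 b1 x0 x1 x2 x3 x4 x6"
  by (simp add: quadric_eq_def power2_eq_square algebra_simps)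

text \<open>\<open>zero_points\<close> asks for some representing vector with value 0; homogeneity
  of any degree \<open>n\<close> makes the choice of vector immaterial.\<close>

lemma pt_in_zero_points_iff:
  assumes "\<And>k v. F (k *s v) = k ^ n * F v" "v \<noteq> 0"
  shows "pt v \<in> zero_points F \<longleftrightarrow> F v = 0"
proof
  assume "pt v \<in> zero_points F"
  then obtain w where "w \<noteq> 0" "F w = 0" "pt v = pt w" by (auto simp: zero_points_def)
  then show "F v = 0" using pt_eq_iff[OF assms(2)] assms(1) by auto
next
  assume "F v = 0"
  then show "pt v \<in> zero_points F" using assms(2) by (auto simp: zero_points_def)
qed

lemma UNIV_6: "UNIV = {0, 1, 2, 3, 4, 5 :: 6}"
proof (rule sym, rule card_subset_eq)
  show "card {0, 1, 2, 3, 4, 5 :: 6} = card (UNIV :: 6 set)" by simp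
qed simp_all

lemma vec6_eq_iff:
  "(v :: 'k ^ 6) = w \<longleftrightarrow> v $ 0 = w $ 0 \<and> v $ 1 = w $ 1 \<and> v $ 2 = w $ 2 \<and> v $ 3 = w $ 3
     \<and> v $ 4 = w $ 4 \<and> v $ 5 = w $ 5"
proof -
  have "(\<forall>i. v $ i = w $ i) \<longleftrightarrow> (\<forall>i \<in> {0, 1, 2, 3, 4, 5 :: 6}. v $ i = w $ i)"
    unfolding UNIV_6[symmetric] by simp
  then show ?thesis by (simp add: vec_eq_iff)
qed

lemma cone_form_scale: "cone_form \<delta> a0 a1 b1 (k *s v) = k ^ 2 * cone_form \<delta> a0 a1 b1 v"
  by (simp add: cone_form_def quadric_eq_scale)

lemma base_form_scale: "base_form \<delta> a0 a1 b1 (k *s v) = k ^ 2 * base_form \<delta> a0 a1 b1 v"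
  by (simp add: base_form_def quadric_eq_scale)

text \<open>Cramer's rule: both unknowns, multiplied by the determinant up to sign, are combinations
  of the two left sides.\<close>

lemma binary_radical_trivial:
  fixes A B C x y :: "'k::field"
  assumes "A * x + B * y = 0" "B * x + C * y = 0" "B ^ 2 - A * C \<noteq> 0"
  shows "x = 0 \<and> y = 0"
proof -
  have "(B ^ 2 - A * C) * x = B * (B * x + C * y) - C * (A * x + B * y)"
    "(B ^ 2 - A * C) * y = B * (A * x + B * y) - A * (B * x + C * y)"
    by (simp_all add: power2_eq_square algebra_simps)
  then have "(B ^ 2 - A * C) * x = 0" "(B ^ 2 - A * C) * y = 0"
    by (simp_all only: assms(1,2) mult_zero_right diff_self)
  then show ?thesis using assms(3) by simp
qed

section \<open>Radicals of the forms of the base and of the cone\<close>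

context
  fixes \<delta> a0 a1 b1 :: "'f::field"
  assumes two: "(2 :: 'f) \<noteq> 0" and disc: "a0 ^ 2 - (a1 - b1) * (\<delta> * (a1 + b1)) \<noteq> 0"
begin

text \<open>Stated for coordinates instead of vectors, so that it applies in both
  dimensions.\<close>

lemma quadric_eq_radical:
  assumes "\<And>y0 y1 y2 y3 y4 y6.
    quadric_eq \<delta> a0 a1 b1 (x0 + y0) (x1 + y1) (x2 + y2) (x3 + y3) (x4 + y4) (x6 + y6)
     - quadric_eq \<delta> a0 a1 b1 x0 x1 x2 x3 x4 x6 - quadric_eq \<delta> a0 a1 b1 y0 y1 y2 y3 y4 y6 = 0"
  shows "x0 = 0 \<and> x1 = 0 \<and> x2 = 0 \<and> x3 = 0 \<and> x4 = 0 \<and> x6 = 0"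
proof -
  have p: "x0 * y6 + x6 * y0 + 2 * (((a1 - b1) * x1 + a0 * x2) * y1 + (a0 * x1 + \<delta> * (a1 + b1) * x2) * y2
       + ((a1 - b1) * x3 + a0 * x4) * y3 + (a0 * x3 + \<delta> * (a1 + b1) * x4) * y4) = 0"
    for y0 y1 y2 y3 y4 y6
    using assms unfolding quadric_eq_polar .
  \<comment> \<open>The unit vectors are inserted in turn. Arguments follow the order of occurrence
    in \<open>p\<close>, so \<open>y6\<close> comes first and \<open>y0\<close> second.\<close>
  have "x0 = 0" using p[of 1 0 0 0 0 0] by simp
  moreover have "x6 = 0" using p[of 0 1 0 0 0 0] by simp
  moreover have "x1 = 0 \<and> x2 = 0"
    \<comment> \<open>Without \<open>distrib_left_numeral\<close> the factor 2 stays outside the sum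
      and can be cancelled by \<open>two\<close>.\<close>
    using p[of 0 0 1 0 0 0] p[of 0 0 0 1 0 0] two disc
    by (intro binary_radical_trivial[of "a1 - b1" _ a0 _ "\<delta> * (a1 + b1)"])
       (simp_all del: distrib_left_numeral)
  moreover have "x3 = 0 \<and> x4 = 0"
    using p[of 0 0 0 0 1 0] p[of 0 0 0 0 0 1] two disc
    by (intro binary_radical_trivial[of "a1 - b1" _ a0 _ "\<delta> * (a1 + b1)"])
       (simp_all del: distrib_left_numeral)
  ultimately show ?thesis by simp
qed

lemma nondegenerate_base: "nondegenerate_quadric (base_form \<delta> a0 a1 b1)"
proof -
  have "v = 0" if "\<And>w. polar_form (base_form \<delta> a0 a1 b1) v w = 0" for v
  proof -
    have "v $ 0 = 0 \<and> v $ 1 = 0 \<and> v $ 2 = 0 \<and> v $ 3 = 0 \<and> v $ 4 = 0 \<and> v $ 5 = 0"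
    proof (rule quadric_eq_radical)
      fix y0 y1 y2 y3 y4 y6
      show "quadric_eq \<delta> a0 a1 b1 (v $ 0 + y0) (v $ 1 + y1) (v $ 2 + y2) (v $ 3 + y3) (v $ 4 + y4) (v $ 5 + y6)
         - quadric_eq \<delta> a0 a1 b1 (v $ 0) (v $ 1) (v $ 2) (v $ 3) (v $ 4) (v $ 5)
         - quadric_eq \<delta> a0 a1 b1 y0 y1 y2 y3 y4 y6 = 0"
        using that[of "coords [y0, y1, y2, y3, y4, y6]"]
        by (simp add: polar_form_def base_form_def coords6)
    qed
    then show ?thesis by (simp add: vec6_eq_iff)
  qed
  moreover have "quadratic_form (base_form \<delta> a0 a1 b1)"
    unfolding base_form_def[abs_def] by (rule quadratic_form_quadric_eq)
  ultimately show ?thesis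
    unfolding nondegenerate_quadric_def singular_points_def by blast
qed

text \<open>Coordinate 5 is the only one absent from the form, and the form is non-degenerate in the
  others, so the radical is the axis of that coordinate.\<close>

lemma singular_points_cone:
  "singular_points (cone_form \<delta> a0 a1 b1) = {pt (coords [0, 0, 0, 0, 0, 1, 0])}" (is "?S = {pt ?e}")
proof
  show "{pt ?e} \<subseteq> ?S"
    unfolding singular_points_def
    by (auto intro!: exI[of _ ?e]
        simp: polar_form_def cone_form_def coords7 vec7_eq_iff quadric_eq_def)
  show "?S \<subseteq> {pt ?e}"
  proof
    fix P assume "P \<in> ?S"
    then obtain v where v: "P = pt v" "v \<noteq> 0"
      and p: "\<And>w. polar_form (cone_form \<delta> a0 a1 b1) v w = 0"
      by (auto simp: singular_points_def)
    have "v $ 0 = 0 \<and> v $ 1 = 0 \<and> v $ 2 = 0 \<and> v $ 3 = 0 \<and> v $ 4 = 0 \<and> v $ 6 = 0"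
    proof (rule quadric_eq_radical)
      fix y0 y1 y2 y3 y4 y6
      show "quadric_eq \<delta> a0 a1 b1 (v $ 0 + y0) (v $ 1 + y1) (v $ 2 + y2) (v $ 3 + y3) (v $ 4 + y4) (v $ 6 + y6)
         - quadric_eq \<delta> a0 a1 b1 (v $ 0) (v $ 1) (v $ 2) (v $ 3) (v $ 4) (v $ 6)
         - quadric_eq \<delta> a0 a1 b1 y0 y1 y2 y3 y4 y6 = 0"
        using p[of "coords [y0, y1, y2, y3, y4, 0, y6]"]
        by (simp add: polar_form_def cone_form_def coords7)
    qed
    then have "v = v $ 5 *s ?e" by (simp add: vec7_eq_iff coords7)
    moreover have "v $ 5 \<noteq> 0" using v(2) calculation by auto
    ultimately show "P \<in> {pt ?e}" using v pt_eq_iff by blast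
  qed
qed

end

section \<open>The quadric as a cone, and its base as a hyperbolic quadric\<close>

lemma cone_form_add_vertex:
  "cone_form \<delta> a0 a1 b1 (t *s coords [0, 0, 0, 0, 0, 1, 0] + base_embed y) = base_form \<delta> a0 a1 b1 y"
  by (simp add: cone_form_def base_form_def base_embed_def coords7)

lemma base_embed_scale: "base_embed (k *s y) = k *s base_embed y"
  by (simp add: vec7_eq_iff base_embed_def coords7)

lemma base_embed_pt: "base_embed ` pt y = pt (base_embed y)"
  unfolding pt_alt by (auto simp: base_embed_scale image_image)

lemma span_pair: "vec.span {v, w :: 'k::field ^ 'n::finite} = {s *s v + t *s w | s t. True}"
proof -
  have "vec.span {v, w} = {x + y | x y. x \<in> vec.span {v} \<and> y \<in> vec.span {w}}"
    using vec.span_Un[of "{v}" "{w}"] by (simp only: insert_is_Un[symmetric])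
  then show ?thesis unfolding vec.span_singleton by auto
qed

lemma span_pt_Un_pt: "vec.span (pt v \<union> pt w) = {s *s v + t *s w | s t. True}"
proof -
  have "vec.span (pt v \<union> pt w) = {x + y | x y. x \<in> pt v \<and> y \<in> pt w}"
    unfolding vec.span_Un by (simp add: pt_def vec.span_span)
  then show ?thesis unfolding pt_alt by auto
qed

text \<open>Every vector is a multiple of the vertex vector plus an embedded vector of the base, and
  the form sees only the second summand.\<close>

lemma cone_form_zero_points_eq_cone:
  "zero_points (cone_form \<delta> a0 a1 b1) =
     cone_over (pt (coords [0, 0, 0, 0, 0, 1, 0])) ((`) base_embed ` zero_points (base_form \<delta> a0 a1 b1))"
  (is "?B' = cone_over (pt ?e) ((`) base_embed ` ?B0)")
proof
  show "?B' \<subseteq> cone_over (pt ?e) ((`) base_embed ` ?B0)"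
  proof
    fix P assume "P \<in> ?B'"
    then obtain v where v: "P = pt v" "v \<noteq> 0" "cone_form \<delta> a0 a1 b1 v = 0"
      by (auto simp: zero_points_def)
    define y where "y = (coords [v $ 0, v $ 1, v $ 2, v $ 3, v $ 4, v $ 6] :: 'a ^ 6)"
    have dec: "v = v $ 5 *s ?e + base_embed y"
      by (simp add: y_def base_embed_def vec7_eq_iff coords6 coords7)
    have y0: "base_form \<delta> a0 a1 b1 y = 0" using v(3) dec cone_form_add_vertex by metis
    \<comment> \<open>The vertex itself lies on the line through any point of the base.\<close>
    obtain z k where z: "z \<noteq> 0" "base_form \<delta> a0 a1 b1 z = 0" "y = k *s z"
    proof (cases "y = 0")
      case True
      show thesis
        by (rule that[of "coords [1, 0, 0, 0, 0, 0]" 0])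
           (simp_all add: True vec6_eq_iff coords6 base_form_def quadric_eq_def)
    next
      case False
      then show thesis using that[of y 1] y0 by simp
    qed
    have "v \<in> vec.span (pt ?e \<union> pt (base_embed z))"
      unfolding span_pt_Un_pt using dec unfolding z(3) base_embed_scale by blast
    then have "P \<subseteq> vec.span (pt ?e \<union> base_embed ` pt z)"
      unfolding v(1) base_embed_pt by (subst pt_def) (rule vec.span_minimal; simp)
    moreover have "pt z \<in> ?B0" using z by (auto simp: zero_points_def)
    ultimately show "P \<in> cone_over (pt ?e) ((`) base_embed ` ?B0)"
      using v pt_in_proj_points unfolding cone_over_def by blast
  qed
  show "cone_over (pt ?e) ((`) base_embed ` ?B0) \<subseteq> ?B'"
  proof
    fix P assume "P \<in> cone_over (pt ?e) ((`) base_embed ` ?B0)"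
    then obtain y where P: "P \<in> proj_points" "P \<subseteq> vec.span (pt ?e \<union> pt (base_embed y))"
      and y: "base_form \<delta> a0 a1 b1 y = 0"
      by (auto simp: cone_over_def zero_points_def base_embed_pt)
    obtain v where v: "v \<noteq> 0" "P = pt v" using P(1) by (metis proj_points_cases)
    have "v \<in> P" unfolding v pt_def by (simp add: vec.span_base)
    then obtain s t where "v = s *s ?e + t *s base_embed y"
      using P(2) unfolding span_pt_Un_pt by blast
    then have "cone_form \<delta> a0 a1 b1 v = 0"
      using y by (simp add: cone_form_add_vertex base_form_scale flip: base_embed_scale)
    then show "P \<in> ?B'" using v by (auto simp: zero_points_def)
  qed
qed

text \<open>With \<open>S\<close> the matrix of the binary form \<open>f\<close> and \<open>J\<close> the rotation by a right angle,
  \<open>(x1, x2) \<mapsto> x (x1, x2) + y J S (x1, x2)\<close> multiplies \<open>f\<close> by \<open>x\<^sup>2 + y\<^sup>2 det S\<close>.  If this factor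
  is -1, the graph of the map is totally singular for the sum of two copies of \<open>f\<close>.\<close>
lemma hyperbolic_base:
  fixes \<delta> a0 a1 b1 :: "'f::{field, finite}"
  assumes odd: "odd (CARD('f))" and disc: "a0 ^ 2 - (a1 - b1) * (\<delta> * (a1 + b1)) \<noteq> 0"
  shows "hyperbolic_quadric (base_form \<delta> a0 a1 b1)"
proof -
  define A C where "A = a1 - b1" and "C = \<delta> * (a1 + b1)"
  have "A * C - a0 ^ 2 \<noteq> 0" using disc by (simp add: A_def C_def)
  then obtain x y where xy: "x ^ 2 + (A * C - a0 ^ 2) * y ^ 2 = -1"
    using binary_diagonal_form_surj[OF odd] by metis
  \<comment> \<open>The last coordinate 0 kills the product \<open>x0 * x6\<close> and leaves
    \<open>s\<close> free. This adds a third dimension to the two of the graph.\<close>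
  define g :: "'f \<Rightarrow> 'f \<Rightarrow> 'f \<Rightarrow> 'f ^ 6" where
    "g s x1 x2 = coords [s, x1, x2, x * x1 - y * (a0 * x1 + C * x2), x * x2 + y * (A * x1 + a0 * x2), 0]"
    for s x1 x2
  define U where "U = {g s x1 x2 | s x1 x2. True}"
  have g_add: "g s x1 x2 + g s' x1' x2' = g (s + s') (x1 + x1') (x2 + x2')" for s x1 x2 s' x1' x2'
    by (simp add: g_def vec6_eq_iff coords6 algebra_simps)
  have g_scale: "k *s g s x1 x2 = g (k * s) (k * x1) (k * x2)" for k s x1 x2
    by (simp add: g_def vec6_eq_iff coords6 algebra_simps)
  have g_eq_iff: "g s x1 x2 = g s' x1' x2' \<longleftrightarrow> s = s' \<and> x1 = x1' \<and> x2 = x2'" for s x1 x2 s' x1' x2'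
    by (auto simp: g_def vec6_eq_iff coords6)
  have g_0: "g 0 0 0 = 0" by (simp add: g_def vec6_eq_iff coords6)
  have sub: "vec.subspace U"
    unfolding vec.subspace_def U_def using g_0 by (auto simp: g_add g_scale) metis+
  let ?b = "{g 1 0 0, g 0 1 0, g 0 0 1}"
  have U: "U = vec.span ?b"
  proof
    show "vec.span ?b \<subseteq> U" by (rule vec.span_minimal[OF _ sub]) (auto simp: U_def)
    show "U \<subseteq> vec.span ?b"
    proof
      fix u assume "u \<in> U"
      then obtain s x1 x2 where "u = g s x1 x2" by (auto simp: U_def)
      then have "u = s *s g 1 0 0 + x1 *s g 0 1 0 + x2 *s g 0 0 1" by (simp add: g_add g_scale)
      then show "u \<in> vec.span ?b"
        by (simp add: vec.span_add vec.span_scale vec.span_base)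
    qed
  qed
  have "g 1 0 0 \<notin> vec.span {g 0 1 0, g 0 0 1}" "g 0 1 0 \<notin> vec.span {g 0 0 1}" "g 0 0 1 \<noteq> 0"
    unfolding g_0[symmetric] by (auto simp: span_pair vec.span_singleton g_add g_scale g_eq_iff)
  then have "vec.independent ?b" by (simp add: vec.independent_insert g_eq_iff)
  then have "vec.dim U = 3"
    using vec.dim_span_eq_card_independent[of ?b] by (simp add: U g_eq_iff)
  moreover have "base_form \<delta> a0 a1 b1 u = 0" if u: "u \<in> U" for u
  proof -
    obtain s x1 x2 where u: "u = g s x1 x2" using u by (auto simp: U_def)
    let ?f = "\<lambda>z1 z2. A * z1 ^ 2 + 2 * a0 * (z1 * z2) + C * z2 ^ 2"
    let ?z1 = "x * x1 - y * (a0 * x1 + C * x2)" and ?z2 = "x * x2 + y * (A * x1 + a0 * x2)"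
    have "base_form \<delta> a0 a1 b1 u = ?f x1 x2 + ?f ?z1 ?z2"
      unfolding base_form_def u g_def coords6 quadric_eq_def A_def[symmetric] C_def[symmetric]
      by (simp add: A_def C_def left_diff_distrib) (simp add: algebra_simps)
    also have "?f ?z1 ?z2 = (x ^ 2 + (A * C - a0 ^ 2) * y ^ 2) * ?f x1 x2"
      by (simp add: power2_eq_square algebra_simps)
    finally show ?thesis unfolding xy by simp
  qed
  ultimately show ?thesis
    unfolding hyperbolic_quadric_def
    using nondegenerate_base[OF two_neq_0_odd_CARD[OF odd] disc] sub by auto
qed


section \<open>The Barlotti--Cofman representation of the surface\<close>

text \<open>The order of the field is a power of the prime below \<open>q\<close>, so that prime is
  the characteristic.\<close>

lemma freshmans_dream_CARD:
  fixes x y :: "'e::{field, finite}"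
  assumes "primepow q" "CARD('e) = q ^ n"
  shows "(x + y) ^ q = x ^ q + y ^ q"
proof -
  obtain p k where p: "prime p" "q = p ^ k"
    using assms(1) unfolding primepow_def by auto
  have "CHAR('e) dvd p ^ (k * n)"
    using CHAR_dvd_CARD[where 'a = 'e] assms(2) p(2) by (simp add: power_mult)
  moreover have "prime CHAR('e)"
    using finite_imp_CHAR_pos[where 'a = 'e] by (intro prime_CHAR_semidom) simp
  ultimately have "CHAR('e) = p"
    using p(1) by (metis prime_dvd_power primes_dvd_imp_eq)
  then show ?thesis
    using p by (intro freshmans_dream') simp_all
qed

locale bc_surface =
  fixes emb :: "'f::{field, finite} \<Rightarrow> 'e::{field, finite}"
    and q :: nat
    and eps a b :: 'e
    and \<delta> a0 a1 b0 b1 :: 'f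
  assumes q: "primepow q" "odd q"
    and card_f: "CARD('f) = q" and card_e: "CARD('e) = q ^ 2" and emb: "field_embedding emb"
    and eps: "eps \<notin> range emb" and eps_q: "eps ^ q = - eps" and delta: "emb \<delta> = eps ^ 2"
    and a: "a = emb a0 + eps * emb a1" and a_nz: "a \<noteq> 0"
    and b: "b = emb b0 + eps * emb b1" and b_nin: "b \<notin> range emb"
    and nondeg: "4 * a ^ (q + 1) + (b ^ q - b) ^ 2 \<noteq> 0"
begin

section \<open>Frobenius map, norm and the surface equation in coordinates\<close>

lemma card_e': "CARD('e) = CARD('f) ^ 2"
  by (simp add: card_f card_e)

lemmas bc = emb eps card_e'
lemmas emb_add = emb_simps(2)[OF bc] and emb_mult = emb_simps(3)[OF bc]
lemmas emb_1' = emb_simps(1)[OF bc] and emb_0' = emb_0[OF bc] and emb_diff' = emb_diff[OF bc]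
  and emb_0_iff' = emb_0_iff[OF bc]

lemma emb_minus: "emb (- x) = - emb x"
  using emb_diff'[of 0 x] by (simp add: emb_0')

lemma emb_power: "emb (x ^ n) = emb x ^ n"
  by (induction n) (simp_all add: emb_1' emb_mult)

lemma odd_CARD: "odd (CARD('f))" "odd (CARD('e))"
  using q card_f card_e by simp_all

lemma two_neq_0: "(2 :: 'f) \<noteq> 0" "(2 :: 'e) \<noteq> 0"
  using odd_CARD two_neq_0_odd_CARD by blast+

lemma eps_nz: "eps \<noteq> 0"
  using eps emb_0' by (metis rangeI)

lemma q_ge_3: "3 \<le> q"
  using q primepow_gt_Suc_0[OF q(1)] by (cases "q = 2") auto

lemma frobenius_add: "(x + y :: 'e) ^ q = x ^ q + y ^ q"
  using freshmans_dream_CARD[OF q(1) card_e] .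

lemma frobenius_split: "(emb x + eps * emb y) ^ q = emb x - eps * emb y"
proof -
  have "emb x ^ q = emb x" for x
    using power_CARD_eq_self[of x] by (simp add: card_f flip: emb_power)
  then show ?thesis by (simp add: frobenius_add power_mult_distrib eps_q)
qed

lemma emb_numeral_2: "emb 2 = 2"
  by (metis emb_1' emb_add one_add_one)

text \<open>The power \<open>q + 1\<close> is the product of an element with its conjugate, which is
  the norm to the small field.\<close>

lemma norm_split: "(emb x + eps * emb y) ^ (q + 1) = emb (x ^ 2 - \<delta> * y ^ 2)"
  by (simp add: frobenius_split emb_diff' emb_mult emb_power delta power2_eq_square algebra_simps)

lemma b_q: "b ^ q - b = - 2 * eps * emb b1"
  by (simp add: b frobenius_split)

lemma b1_nz: "b1 \<noteq> 0"
  using b b_nin by (auto simp: emb_0')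

lemma b_q_nz: "b ^ q - b \<noteq> 0"
  unfolding b_q using two_neq_0 eps_nz b1_nz by (simp add: emb_0_iff')

text \<open>This is \<open>nondeg\<close> in coordinates: \<open>a ^ (q + 1)\<close> is the norm
  \<open>a0 ^ 2 - \<delta> * a1 ^ 2\<close>, and \<open>(b ^ q - b) ^ 2\<close> equals
  \<open>4 * \<delta> * b1 ^ 2\<close>, both up to \<open>emb\<close>.\<close>

lemma disc: "a0 ^ 2 - (a1 - b1) * (\<delta> * (a1 + b1)) \<noteq> 0"
proof
  assume "a0 ^ 2 - (a1 - b1) * (\<delta> * (a1 + b1)) = 0"
  then have "0 = 4 * emb (a0 ^ 2 - \<delta> * a1 ^ 2 + \<delta> * b1 ^ 2)"
    by (simp add: power2_eq_square algebra_simps emb_0')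
  also have "\<dots> = 4 * a ^ (q + 1) + (b ^ q - b) ^ 2"
    unfolding b_q by (simp only: a norm_split emb_add emb_mult emb_power delta power_mult_distrib)
      (simp add: algebra_simps)
  finally show False using nondeg by simp
qed

text \<open>\<open>X\<close> and \<open>Y\<close> enter the surface equation through this one
  expression. The first two terms are \<open>c ^ q - c\<close> for \<open>c = a * X ^ 2\<close>,
  that is, \<open>- 2 * eps\<close> times the second component of \<open>c\<close>; the last term is
  a multiple of the norm of \<open>X\<close>.\<close>

lemma form_split:
  "a ^ q * (emb x + eps * emb y) ^ (2 * q) - a * (emb x + eps * emb y) ^ 2
      - (b ^ q - b) * (emb x + eps * emb y) ^ (q + 1)
   = - 2 * eps * emb (2 * a0 * (x * y) + a1 * (x ^ 2 + \<delta> * y ^ 2) - b1 * (x ^ 2 - \<delta> * y ^ 2))"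
proof -
  have X2: "(emb x + eps * emb y) ^ (2 * q) = (emb x - eps * emb y) ^ 2"
    by (metis frobenius_split mult.commute power_mult)
  show ?thesis
    unfolding X2 norm_split b_q a frobenius_split
    by (simp add: emb_diff' emb_add emb_mult emb_power emb_numeral_2 delta power2_eq_square algebra_simps)
qed

text \<open>The first coordinate stays free: \<open>j = 1\<close> gives the affine equation of the
  surface, and \<open>j = 0\<close> evaluates the cone on spread lines.\<close>

lemma cone_form_bc_vec:
  "- 2 * eps * emb (cone_form \<delta> a0 a1 b1 (bc_vec emb eps j X Y Z)) =
     emb j * (Z ^ q - Z) + a ^ q * (X ^ (2 * q) + Y ^ (2 * q)) - a * (X ^ 2 + Y ^ 2)
       - (b ^ q - b) * (X ^ (q + 1) + Y ^ (q + 1))"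
proof -
  obtain x1 x2 x3 x4 x5 x6 where X: "X = emb x1 + eps * emb x2" and Y: "Y = emb x3 + eps * emb x4"
    and Z: "Z = emb x5 + eps * emb x6"
    using split_exists[OF bc] by metis
  let ?f = "\<lambda>x y. 2 * a0 * (x * y) + a1 * (x ^ 2 + \<delta> * y ^ 2) - b1 * (x ^ 2 - \<delta> * y ^ 2)"
  have "cone_form \<delta> a0 a1 b1 (bc_vec emb eps j X Y Z) = j * x6 + ?f x1 x2 + ?f x3 x4"
    unfolding X Y Z bc_vec_def parts_split[OF bc] cone_form_def coords7 quadric_eq_def
    by (simp add: algebra_simps)
  moreover have "Z ^ q - Z = - 2 * eps * emb x6" by (simp add: Z frobenius_split)
  ultimately have "- 2 * eps * emb (cone_form \<delta> a0 a1 b1 (bc_vec emb eps j X Y Z)) =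
      emb j * (Z ^ q - Z) + (- 2 * eps * emb (?f x1 x2)) + (- 2 * eps * emb (?f x3 x4))"
    by (simp only: emb_add emb_mult distrib_left mult.assoc mult.left_commute)
  also have "\<dots> = emb j * (Z ^ q - Z) + a ^ q * (X ^ (2 * q) + Y ^ (2 * q)) - a * (X ^ 2 + Y ^ 2)
       - (b ^ q - b) * (X ^ (q + 1) + Y ^ (q + 1))"
    unfolding form_split[symmetric] X[symmetric] Y[symmetric]
    by (simp only: distrib_left) simp
  finally show ?thesis .
qed

section \<open>Affine points of the surface\<close>

lemma surface_eq_scale: "surface_eq q a b (k *s v) = k ^ (2 * q) * surface_eq q a b v"
proof -
  \<comment> \<open>This substitution removes the truncated subtractions from the exponents of
    \<open>J\<close>.\<close>
  obtain m where m: "q = Suc m" using q_ge_3 by (cases q) auto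
  have "k ^ (m * 2) = k ^ m * k ^ m" by (simp add: mult_2_right power_add)
  then show ?thesis
    unfolding surface_eq_def Let_def vector_smult_component power_mult_distrib m
    by (simp add: power_mult_distrib power_add mult_2 power2_eq_square algebra_simps)
qed

lemma surface_eq_affine:
  "surface_eq q a b (coords [1, X, Y, Z]) =
     - 2 * eps * emb (cone_form \<delta> a0 a1 b1 (bc_vec emb eps 1 X Y Z))"
  unfolding cone_form_bc_vec by (simp add: surface_eq_def Let_def coords4 emb_1')

text \<open>All exponents of \<open>J\<close> are positive because \<open>q\<close> is at least 3,
  so only the terms without \<open>J\<close> survive, and additivity of the Frobenius map collects
  them in one power.\<close>

lemma surface_eq_infinite: "surface_eq q a b (coords [0, u, v, w]) = a ^ q * (u ^ 2 + v ^ 2) ^ q"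
  using q_ge_3 by (simp add: surface_eq_def Let_def coords4 frobenius_add power_0_left flip: power_mult)

lemma affine_point_in_surface_iff:
  "pt (coords [1, X, Y, Z]) \<in> surface q a b \<longleftrightarrow>
     cone_form \<delta> a0 a1 b1 (bc_vec emb eps 1 X Y Z) = 0"
proof -
  have "(coords [1, X, Y, Z] :: 'e ^ 4) \<noteq> 0" by (simp add: vec4_eq_iff coords4)
  then show ?thesis
    using pt_in_zero_points_iff[OF surface_eq_scale] two_neq_0 eps_nz
    by (simp add: surface_def surface_eq_affine emb_0_iff')
qed

lemma bc_vec_first: "bc_vec emb eps j X Y Z $ 0 = j"
  by (simp add: bc_vec_def coords7)

lemma bc_affine_surface:
  "bc_affine emb eps (surface q a b) = affine_part (zero_points (cone_form \<delta> a0 a1 b1))"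
proof
  show "bc_affine emb eps (surface q a b) \<subseteq> affine_part (zero_points (cone_form \<delta> a0 a1 b1))"
  proof
    fix R assume "R \<in> bc_affine emb eps (surface q a b)"
    then obtain X Y Z where R: "R = pt (bc_vec emb eps 1 X Y Z)"
      "cone_form \<delta> a0 a1 b1 (bc_vec emb eps 1 X Y Z) = 0"
      by (auto simp: bc_affine_def affine_point_in_surface_iff)
    moreover have "bc_vec emb eps 1 X Y Z \<noteq> 0"
      by (metis bc_vec_first zero_index zero_neq_one)
    ultimately show "R \<in> affine_part (zero_points (cone_form \<delta> a0 a1 b1))"
      by (auto simp: affine_part_def zero_points_def at_infinity_pt bc_vec_first)
  qed
  show "affine_part (zero_points (cone_form \<delta> a0 a1 b1)) \<subseteq> bc_affine emb eps (surface q a b)"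
  proof
    fix R assume "R \<in> affine_part (zero_points (cone_form \<delta> a0 a1 b1))"
    then obtain x where x: "R = pt x" "cone_form \<delta> a0 a1 b1 x = 0" "x $ 0 \<noteq> 0"
      by (auto simp: affine_part_def zero_points_def at_infinity_pt)
    \<comment> \<open>An affine point is the image of a point of the large space once its first
      coordinate is normalised to 1.\<close>
    define y where "y = inverse (x $ 0) *s x"
    have "pt y = pt x"
      using x by (subst pt_eq_iff) (auto simp: y_def vec_eq_iff intro!: exI[of _ "inverse (x $ 0)"])
    moreover have "y $ 0 = 1" using x(3) by (simp add: y_def)
    moreover have "cone_form \<delta> a0 a1 b1 y = 0" by (simp add: y_def cone_form_scale x(2))
    ultimately show "R \<in> bc_affine emb eps (surface q a b)"
      using bc_vec_exists[OF bc, of y] x(1)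
      by (auto simp: bc_affine_def affine_point_in_surface_iff)
  qed
qed

section \<open>Points of the surface at infinity\<close>

lemma infinite_point_in_surface_iff:
  assumes "(coords [0, u, v, w] :: 'e ^ 4) \<noteq> 0"
  shows "pt (coords [0, u, v, w]) \<in> infinite_part (surface q a b) \<longleftrightarrow> u ^ 2 + v ^ 2 = 0"
  using pt_in_zero_points_iff[OF surface_eq_scale assms] a_nz q_ge_3
  by (simp add: infinite_part_def at_infinity_pt coords4 surface_def surface_eq_infinite)

lemma infinite_part_surface_subset: "infinite_part (surface q a b) \<subseteq> infinite_part proj_points"
  by (auto simp: infinite_part_def surface_def zero_points_def intro: pt_in_proj_points)

text \<open>The root is \<open>z ^ ((q + 1) / 2)\<close> for an element \<open>z\<close> of norm -1.\<close>
lemma sqrt_minus_1: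
  obtains i :: 'e where "i ^ 2 = -1" "i ^ (q + 1) = (-1) ^ ((q + 1) div 2)"
proof -
  \<comment> \<open>Since \<delta> is nonzero, the norm form represents every element, in particular
    -1.\<close>
  have "\<delta> \<noteq> 0" using delta eps_nz by (auto simp: emb_0')
  then obtain x y where "x ^ 2 + (- \<delta>) * y ^ 2 = -1"
    using binary_diagonal_form_surj[OF odd_CARD(1), of "- \<delta>"] by auto
  then have z: "(emb x + eps * emb y) ^ (q + 1) = -1"
    unfolding norm_split by (simp add: emb_minus emb_1')
  define m where "m = (q + 1) div 2"
  have m: "q + 1 = m * 2" using q(2) unfolding m_def by presburger
  define i where "i = (emb x + eps * emb y) ^ m"
  have i: "i ^ 2 = -1" using z unfolding i_def m power_mult .
  have "i ^ (q + 1) = (i ^ 2) ^ m" unfolding m mult.commute[of m] power_mult ..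
  then show thesis using that[of i] i unfolding m_def by simp
qed

text \<open>The two lines \<open>v = i * u\<close> and \<open>v = - i * u\<close> meet in the point
  with \<open>u = v = 0\<close>. Listing it apart lets every other point be normalised to
  \<open>u = 1\<close>, which makes the parameters \<open>s\<close>, \<open>w\<close>
  unique.\<close>

lemma infinite_part_surface:
  assumes i: "i ^ 2 = (-1 :: 'e)"
  shows "infinite_part (surface q a b) =
    insert (pt (coords [0, 0, 0, 1])) ((\<lambda>(s, w). pt (coords [0, 1, s, w])) ` ({i, - i} \<times> UNIV))"
    (is "?I = insert ?N ?M")
proof
  show "insert ?N ?M \<subseteq> ?I"
    using i by (auto simp: infinite_point_in_surface_iff coords_inf_0_iff[OF bc])
  show "?I \<subseteq> insert ?N ?M"
  proof
    fix P assume P: "P \<in> ?I"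
    then obtain u v w where nz: "(coords [0, u, v, w] :: 'e ^ 4) \<noteq> 0" and Puvw: "P = pt (coords [0, u, v, w])"
      using infinite_part_surface_subset infinite_point_cases[OF bc] by blast
    have uv: "u ^ 2 + v ^ 2 = 0" using P Puvw infinite_point_in_surface_iff[OF nz] by simp
    show "P \<in> insert ?N ?M"
    proof (cases "u = 0")
      case True
      then have "v = 0" using uv by simp
      then have "coords [0, u, v, w] = w *s (coords [0, 0, 0, 1] :: 'e ^ 4)" "w \<noteq> 0"
        using True nz by (auto simp: coords_inf_scale[OF bc] coords_inf_0_iff[OF bc])
      then have "P = ?N" using Puvw pt_eq_iff[OF nz] by blast
      then show ?thesis by simp
    next
      case False
      have "coords [0, u, v, w] = u *s (coords [0, 1, v / u, w / u] :: 'e ^ 4)"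
        using False by (simp add: coords_inf_scale[OF bc])
      then have "P = pt (coords [0, 1, v / u, w / u])"
        using False Puvw pt_eq_iff[OF nz] by blast
      moreover have "v ^ 2 = - (u ^ 2)" using uv by (simp add: eq_neg_iff_add_eq_0 add.commute)
      then have "(v / u) ^ 2 = i ^ 2" using False i by (simp add: power_divide)
      then have "v / u \<in> {i, - i}" by (auto simp: power2_eq_iff)
      ultimately show ?thesis by auto
    qed
  qed
qed

lemma card_infinite_part_surface: "card (infinite_part (surface q a b)) = 2 * q ^ 2 + 1"
proof -
  obtain i :: 'e where i: "i ^ 2 = -1" using sqrt_minus_1 by blast
  let ?g = "\<lambda>(s, w). pt (coords [0, 1, s, w] :: 'e ^ 4)"
  have nz: "(coords [0, 1, s, w] :: 'e ^ 4) \<noteq> 0" for s w by (simp add: coords_inf_0_iff[OF bc])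
  \<comment> \<open>Odd characteristic separates the two roots, so there are two distinct
    lines.\<close>
  have "i \<noteq> - i"
  proof
    assume "i = - i"
    then have "2 * i = 0" by (metis add.right_inverse mult_2)
    then show False using i two_neq_0(2) by simp
  qed
  then have c: "card ({i, - i} \<times> (UNIV :: 'e set)) = 2 * q ^ 2" by (simp add: card_e)
  have "inj ?g"
    by (auto simp: inj_def pt_eq_iff[OF nz] coords_inf_scale[OF bc]) (auto simp: vec4_eq_iff coords4)
  then have "card (?g ` ({i, - i} \<times> UNIV)) = 2 * q ^ 2"
    using c by (simp add: card_image inj_on_subset)
  moreover have "pt (coords [0, 0, 0, 1]) \<notin> ?g ` ({i, - i} \<times> UNIV)"
    by (auto simp: pt_eq_iff coords_inf_0_iff[OF bc] coords_inf_scale[OF bc]) (auto simp: vec4_eq_iff coords4)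
  ultimately show ?thesis
    unfolding infinite_part_surface[OF i] by (subst card_insert_disjoint) simp_all
qed

section \<open>Spread lines and the cone\<close>

lemma inj_on_spread_line: "inj_on (spread_line emb eps) (infinite_part proj_points)"
proof (rule inj_onI)
  fix P P' :: "('e ^ 4) set"
  assume P: "P \<in> infinite_part proj_points" and P': "P' \<in> infinite_part proj_points"
    and e: "spread_line emb eps P = spread_line emb eps P'"
  obtain u v w where nz: "(coords [0, u, v, w] :: 'e ^ 4) \<noteq> 0" and Puvw: "P = pt (coords [0, u, v, w])"
    using infinite_point_cases[OF bc P] .
  obtain u' v' w' where nz': "(coords [0, u', v', w'] :: 'e ^ 4) \<noteq> 0"
    and P'uvw: "P' = pt (coords [0, u', v', w'])"
    using infinite_point_cases[OF bc P'] .
  \<comment> \<open>One common point of the two spread lines suffices: it makes the coordinates at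
    infinity proportional, with factor \<open>emb k * c\<close>.\<close>
  have "pt (bc_vec emb eps 0 u v w) \<in> spread_line emb eps P"
    unfolding Puvw spread_line_pt[OF bc nz] by (intro CollectI exI[of _ 1]) simp
  then obtain c where c: "c \<noteq> 0"
    "pt (bc_vec emb eps 0 u v w) = pt (bc_vec emb eps 0 (c * u') (c * v') (c * w'))"
    unfolding e P'uvw spread_line_pt[OF bc nz'] by auto
  have uvw_nz: "bc_vec emb eps 0 u v w \<noteq> 0"
    using nz by (simp add: bc_vec_0_iff[OF bc] coords_inf_0_iff[OF bc])
  then obtain k where k: "k \<noteq> 0"
    "bc_vec emb eps 0 u v w = k *s bc_vec emb eps 0 (c * u') (c * v') (c * w')"
    using c(2) pt_eq_iff[OF uvw_nz] by blast
  then have "coords [0, u, v, w] = (emb k * c) *s (coords [0, u', v', w'] :: 'e ^ 4)"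
    by (simp add: bc_vec_scale[OF bc] bc_vec_eq_iff[OF bc] coords_inf_scale[OF bc] mult.assoc)
  moreover have "emb k * c \<noteq> 0" using k c by (simp add: emb_0_iff')
  ultimately show "P = P'" unfolding Puvw P'uvw using pt_eq_iff[OF nz] by blast
qed

text \<open>With first coordinate 0 and \<open>u ^ 2 + v ^ 2 = 0\<close> only the norm term of the
  cone survives. Scaling by \<open>c\<close> multiplies it by the nonzero
  \<open>c ^ (q + 1)\<close>, so such a line lies in the cone or misses it.\<close>

lemma spread_line_subset_cone_iff:
  assumes nz: "(coords [0, u, v, w] :: 'e ^ 4) \<noteq> 0" and uv: "u ^ 2 + v ^ 2 = 0"
  shows "spread_line emb eps (pt (coords [0, u, v, w])) \<subseteq> zero_points (cone_form \<delta> a0 a1 b1)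
     \<longleftrightarrow> u ^ (q + 1) + v ^ (q + 1) = 0"
proof -
  let ?g = "\<lambda>c. bc_vec emb eps 0 (c * u) (c * v) (c * w)"
  have g_nz: "?g c \<noteq> 0" if "c \<noteq> 0" for c
    using that nz by (auto simp: bc_vec_0_iff[OF bc] coords_inf_0_iff[OF bc])
  have "cone_form \<delta> a0 a1 b1 (?g c) = 0 \<longleftrightarrow> u ^ (q + 1) + v ^ (q + 1) = 0" if c: "c \<noteq> 0" for c
  proof -
    have "(c * u) ^ 2 + (c * v) ^ 2 = c ^ 2 * (u ^ 2 + v ^ 2)"
      by (simp add: power_mult_distrib distrib_left)
    then have cuv: "(c * u) ^ 2 + (c * v) ^ 2 = 0" using uv by simp
    have "(c * u) ^ (2 * q) + (c * v) ^ (2 * q) = ((c * u) ^ 2 + (c * v) ^ 2) ^ q"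
      unfolding frobenius_add power_mult ..
    also have "\<dots> = 0" using cuv q_ge_3 by simp
    finally have "- 2 * eps * emb (cone_form \<delta> a0 a1 b1 (?g c)) =
        - (b ^ q - b) * ((c * u) ^ (q + 1) + (c * v) ^ (q + 1))"
      unfolding cone_form_bc_vec cuv by (simp add: emb_0' algebra_simps)
    also have "\<dots> = - (b ^ q - b) * (c ^ (q + 1) * (u ^ (q + 1) + v ^ (q + 1)))"
      by (simp only: power_mult_distrib distrib_left)
    finally have *: "- 2 * eps * emb (cone_form \<delta> a0 a1 b1 (?g c)) =
      - (b ^ q - b) * (c ^ (q + 1) * (u ^ (q + 1) + v ^ (q + 1)))" .
    have "cone_form \<delta> a0 a1 b1 (?g c) = 0 \<longleftrightarrow> - 2 * eps * emb (cone_form \<delta> a0 a1 b1 (?g c)) = 0"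
      using two_neq_0 eps_nz by (simp add: emb_0_iff')
    also have "\<dots> \<longleftrightarrow> u ^ (q + 1) + v ^ (q + 1) = 0"
      unfolding * mult_eq_0_iff neg_equal_0_iff_equal using b_q_nz c by simp
    finally show ?thesis .
  qed
  then have "pt (?g c) \<in> zero_points (cone_form \<delta> a0 a1 b1) \<longleftrightarrow> u ^ (q + 1) + v ^ (q + 1) = 0"
    if "c \<noteq> 0" for c
    using pt_in_zero_points_iff[where F = "cone_form \<delta> a0 a1 b1", OF cone_form_scale g_nz[OF that]] that by blast
  \<comment> \<open>The line has a point at all, so containment in the cone is not vacuous.\<close>
  moreover have "\<exists>c :: 'e. c \<noteq> 0" by (rule exI[of _ 1]) simp
  ultimately show ?thesis unfolding spread_line_pt[OF bc nz] by auto
qed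

text \<open>The point with \<open>u = v = 0\<close> satisfies the norm condition for every
  \<open>q\<close>. At the other points it reads \<open>1 + s ^ (q + 1) = 0\<close> with
  \<open>s ^ 2 = -1\<close>, which the parity of \<open>(q + 1) div 2\<close> decides.\<close>

lemma spread_line_subset_cone_cases:
  assumes P: "P \<in> infinite_part (surface q a b)"
  shows "[q = 1] (mod 4) \<Longrightarrow> spread_line emb eps P \<subseteq> zero_points (cone_form \<delta> a0 a1 b1)"
    and "[q = 3] (mod 4) \<Longrightarrow> spread_line emb eps P \<subseteq> zero_points (cone_form \<delta> a0 a1 b1)
      \<longleftrightarrow> P = pt (coords [0, 0, 0, 1])"
proof -
  obtain i :: 'e where i: "i ^ 2 = -1" "i ^ (q + 1) = (-1) ^ ((q + 1) div 2)"
    using sqrt_minus_1 by blast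
  let ?C = "zero_points (cone_form \<delta> a0 a1 b1)"
  consider (N) "P = pt (coords [0, 0, 0, 1])" | (M) s w where "s \<in> {i, - i}" "P = pt (coords [0, 1, s, w])"
    using P unfolding infinite_part_surface[OF i(1)] by auto
  then have "([q = 1] (mod 4) \<longrightarrow> spread_line emb eps P \<subseteq> ?C) \<and>
    ([q = 3] (mod 4) \<longrightarrow> spread_line emb eps P \<subseteq> ?C \<longleftrightarrow> P = pt (coords [0, 0, 0, 1]))"
  proof cases
    case N
    then show ?thesis
      using spread_line_subset_cone_iff[of 0 0 1] by (simp add: coords_inf_0_iff[OF bc])
  next
    case M
    have nz: "(coords [0, 1, s, w] :: 'e ^ 4) \<noteq> 0" by (simp add: coords_inf_0_iff[OF bc])
    have s: "s ^ 2 = -1" using M(1) i(1) by auto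
    \<comment> \<open>The even exponent gives both roots \<open>i\<close> and \<open>- i\<close> the
      same norm.\<close>
    have "even (q + 1)" using q(2) by simp
    then have "s ^ (q + 1) = (-1) ^ ((q + 1) div 2)" using M(1) i(2) by auto
    then have incl: "spread_line emb eps P \<subseteq> ?C \<longleftrightarrow> 1 + (-1) ^ ((q + 1) div 2) = (0 :: 'e)"
      using spread_line_subset_cone_iff[OF nz] s M(2) by simp
    have "P \<noteq> pt (coords [0, 0, 0, 1])"
      unfolding M(2) pt_eq_iff[OF nz] by (auto simp: vec4_eq_iff coords4)
    moreover have "odd ((q + 1) div 2)" if "[q = 1] (mod 4)"
      using that unfolding cong_def by presburger
    moreover have "even ((q + 1) div 2)" if "[q = 3] (mod 4)"
      using that unfolding cong_def by presburger
    ultimately show ?thesis using incl two_neq_0(2) by auto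
  qed
  then show "[q = 1] (mod 4) \<Longrightarrow> spread_line emb eps P \<subseteq> ?C"
    "[q = 3] (mod 4) \<Longrightarrow> spread_line emb eps P \<subseteq> ?C \<longleftrightarrow> P = pt (coords [0, 0, 0, 1])"
    by simp_all
qed

lemma vertical_point_in_surface: "pt (coords [0, 0, 0, 1]) \<in> infinite_part (surface q a b)"
  by (simp add: infinite_point_in_surface_iff coords_inf_0_iff[OF bc])

end

theorem theorem5p2:
  fixes emb :: "'f::{field, finite} \<Rightarrow> 'e::{field, finite}"
    and q :: nat
    and eps a b :: 'e
    and \<delta> a0 a1 b0 b1 :: 'f
  assumes "primepow q" and "odd q"
    and "CARD('f) = q" and "CARD('e) = q ^ 2" and "field_embedding emb"
    and "eps \<notin> range emb" and "eps ^ q = - eps" and "emb \<delta> = eps ^ 2"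
    and "a = emb a0 + eps * emb a1" and "a \<noteq> 0"
    and "b = emb b0 + eps * emb b1" and "b \<notin> range emb"
    and "4 * a ^ (q + 1) + (b ^ q - b) ^ 2 \<noteq> 0"
  shows "let B = surface q a b;
             V = pt (coords [0, 0, 0, 0, 0, 1, 0]);
             Q' = cone_form \<delta> a0 a1 b1; B' = zero_points Q';
             Q0 = base_form \<delta> a0 a1 b1; B0 = zero_points Q0;
             L = spread_line emb eps ` infinite_part B
         in bc_affine emb eps B = affine_part B'
          \<and> quadratic_form Q' \<and> singular_points Q' = {V}
          \<and> B' = cone_over V ((`) base_embed ` B0)
          \<and> hyperbolic_quadric Q0
          \<and> bc_rep emb eps B = affine_part B' \<union> \<Union>L
          \<and> L \<subseteq> bc_spread emb eps \<and> card L = 2 * q ^ 2 + 1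
          \<and> ([q = 1] (mod 4) \<longrightarrow> (\<forall>l\<in>L. l \<subseteq> B'))
          \<and> ([q = 3] (mod 4) \<longrightarrow> (\<exists>!l. l \<in> L \<and> l \<subseteq> B'))"
proof -
  interpret bc_surface emb q eps a b \<delta> a0 a1 b0 b1
    using assms by unfold_locales
  let ?B = "surface q a b"
  let ?Q' = "cone_form \<delta> a0 a1 b1"
  let ?L = "spread_line emb eps ` infinite_part ?B"
  let ?N = "spread_line emb eps (pt (coords [0, 0, 0, 1]))"
  have form: "quadratic_form ?Q'"
    unfolding cone_form_def[abs_def] by (rule quadratic_form_quadric_eq)
  have rep: "bc_rep emb eps ?B = affine_part (zero_points ?Q') \<union> \<Union>?L"
    unfolding bc_rep_def bc_affine_surface ..
  have spread: "?L \<subseteq> bc_spread emb eps"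
    unfolding bc_spread_def using infinite_part_surface_subset by (rule image_mono)
  have card: "card ?L = 2 * q ^ 2 + 1"
    using card_image[OF inj_on_subset[OF inj_on_spread_line infinite_part_surface_subset]]
      card_infinite_part_surface by simp
  have q1: "\<forall>l\<in>?L. l \<subseteq> zero_points ?Q'" if "[q = 1] (mod 4)"
    using spread_line_subset_cone_cases(1)[OF _ that] by (intro ballI) (erule imageE, simp)
  \<comment> \<open>The unique line \<open>?N\<close> belongs to the point in which the two lines of
    the surface at infinity meet.\<close>
  have q3: "\<exists>!l. l \<in> ?L \<and> l \<subseteq> zero_points ?Q'" if q3: "[q = 3] (mod 4)"
  proof (rule ex1I[of _ ?N])
    show "?N \<in> ?L \<and> ?N \<subseteq> zero_points ?Q'"
      using spread_line_subset_cone_cases(2)[OF vertical_point_in_surface q3]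
        vertical_point_in_surface by simp
    fix l assume l: "l \<in> ?L \<and> l \<subseteq> zero_points ?Q'"
    then obtain P where "P \<in> infinite_part ?B" "l = spread_line emb eps P" by (elim conjE imageE)
    then show "l = ?N" using l spread_line_subset_cone_cases(2)[OF _ q3] by simp
  qed
  show ?thesis
    unfolding Let_def
    by (intro conjI impI bc_affine_surface form singular_points_cone two_neq_0(1) disc
        cone_form_zero_points_eq_cone hyperbolic_base odd_CARD(1) rep spread card)
      (rule q1 q3, assumption)+
qed

end
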